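(* Let $\alpha\in(0,1)$ and let the local dependence structure of the p-values be given by batches $(B_b)_b$. Let $\lambda_{b_i}\in[0,1)$, let $(\gamma_i)_{i\in\mathbb N}$ be a non-negative sequence that sums to $1$, and for every $j\in\mathbb N$ let $(g^*_{j,i})_{i=j+1}^\infty$ be a non-negative sequence such that $g^*_{j,i}=0$ if $b_j=b_i$ and $\sum_{i:\,b_i>b_j}g^*_{j,i}\le1$. Let $\lambda_{b_i}$, $\gamma_i$ and $g^*_{j,i}$ be measurable with respect to $\mathcal F_{b_i-1}=\sigma(\{P_j:b_j<b_i\})$, and put $C_i=\mathbf 1\{P_i\le\lambda_{b_i}\}$. Define (the $\text{Adaptive-Graph}_{\text{corr}}$) $$\alpha_i=(1-\lambda_{b_i})\left(\alpha\gamma_i+\sum_{j:\,b_j<b_i}g^*_{j,i}\,C_j\,\frac{\alpha_j}{1-\lambda_{b_j}}+\sum_{j:\,b_j<b_i}g^*_{j,i}\,(1-C_j)\,\frac{\alpha_j-\alpha_j^{c}}{1-\lambda_{b_j}}\right),\qquad i\in\mathbb N,$$ where $$\alpha_j^{c}=\mathbb P_{H_{\mathbb N}}\left(\bigcap_{k\in B_{b_j},\,k<j,\,C_k=0}\{P_k>\alpha_k\}\cap\{P_j\le\alpha_j\}\ \Big|\ \mathcal F_{b_j-1}\right).$$ Then each $\alpha_i$ is $\mathcal F_{b_i-1}$-measurable and $$\sum_{j=1}^{i}\frac{\alpha_j^{c}}{1-\lambda_{b_j}}(1-C_j)\le\alpha\qquad\text{for all } i\in\mathbb N .$$ Consequently,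 if the subset pivotality condition is satisfied, the procedure that rejects $H_i$ if and only if $P_i\le\alpha_i$ controls the familywise error rate strongly at level $\alpha$, i.e. $\mathrm{FWER}\le\alpha$ for every configuration of true and false null hypotheses.
   Context: Setting: $(H_i)_{i\in\mathbb N}$ is a sequence of null hypotheses with p-values $(P_i)_{i\in\mathbb N}$ in $[0,1]$; $I_0\subseteq\mathbb N$ is the index set of true nulls; null p-values are valid: $\mathbb P(P_i\le x)\le x$ for $i\in I_0$, $x\in[0,1]$ (also under the global null, for all $i$). $\mathrm{FWER}=\mathbb P(\exists\,i\in I_0:P_i\le\alpha_i)$ under the true distribution $\mathbb P$. Batches: $\mathbb N$ is partitioned into consecutive intervals $B_1,B_2,\dots$ of indices (batches; the last one may be infinite). P-values in the same batch may depend on each other arbitrarily, while p-values from different batches are independent (the random vectors $(P_i)_{i\in B_b}$, $b=1,2,\dots$, are independent). $b_i$ denotes the index of the batch containing $i$. The quantity $\lambda_{b}$ is common to all hypotheses in batch $b$. Subset pivotality: for every $I\subseteq\mathbb N$, the distribution of $(P_i)_{i\in I}$ under $H_I=\bigcap_{i\in I}H_i$ is the same as under the global null $H_{\mathbb N}=\bigcap_{i\in\mathbb N}H_i$. $\mathbb P_{H_{\mathbb N}}$ denotes probability under the global null hypothesis (the known joint null distribution of the p-values, for which the batches are also independent). Meaning of $\alpha_j^c$: the index set $K=\{k\in B_{b_j}:k<j,\ C_k=0\}$ is the observed one and is treated as fixed inside the conditional probability. That is, for a fixed $K\subseteq\{k\in B_{b_j}:k<j\}$ set $\alpha_j^{c}(K)=\mathbb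 P_{H_{\mathbb N}}\big(\bigcap_{k\in K}\{P_k>\alpha_k\}\cap\{P_j\le\alpha_j\}\mid\mathcal F_{b_j-1}\big)$, i.e. (as the levels in batch $b_j$ are $\mathcal F_{b_j-1}$-measurable and the batch is independent of $\mathcal F_{b_j-1}$) the function $(a_k)_{k\in K\cup\{j\}}\mapsto\mathbb P_{H_{\mathbb N}}(P_k>a_k\ \forall k\in K,\ P_j\le a_j)$ evaluated at $a_k=\alpha_k$; then $\alpha_j^c=\alpha_j^c(K)$ with $K=\{k\in B_{b_j}:k<j,\ C_k=0\}$. *)

theory Defs
  imports "HOL-Probability.Probability"
begin

(* Hypotheses are indexed by nat from 0. b i is the number of the batch containing i; batches are
   consecutive intervals of indices. If b is bounded there are finitely many batches and the last
   one is infinite. *)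
definition batch_index :: "(nat \<Rightarrow> nat) \<Rightarrow> bool" where
  "batch_index b \<longleftrightarrow> mono b \<and> b 0 = 0 \<and> (\<forall>i. b (Suc i) \<le> Suc (b i))"

definition batch :: "(nat \<Rightarrow> nat) \<Rightarrow> nat \<Rightarrow> nat set" where
  "batch b c = {i. b i = c}"

(* The sigma-algebra generated by the p-values of all batches strictly before batch c,
   i.e. F_(c-1) in the usual notation. *)
definition past_algebra ::
  "'a measure \<Rightarrow> (nat \<Rightarrow> 'a \<Rightarrow> real) \<Rightarrow> (nat \<Rightarrow> nat) \<Rightarrow> nat \<Rightarrow> 'a measure" where
  "past_algebra M P b c =
     sigma (space M) (\<Union>j\<in>{j. b j < c}. {P j -` A \<inter> space M | A. A \<in> sets borel})"

definition pvalue_vector :: "(nat \<Rightarrow> 'a \<Rightarrow> real) \<Rightarrow> nat set \<Rightarrow> 'a \<Rightarrow> nat \<Rightarrow> real" where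
  "pvalue_vector P I \<omega> = (\<lambda>i\<in>I. P i \<omega>)"

definition batches_independent ::
  "'a measure \<Rightarrow> (nat \<Rightarrow> 'a \<Rightarrow> real) \<Rightarrow> (nat \<Rightarrow> nat) \<Rightarrow> bool" where
  "batches_independent Pr P b \<longleftrightarrow>
     prob_space.indep_vars Pr (\<lambda>c. PiM (batch b c) (\<lambda>_. borel))
       (\<lambda>c. pvalue_vector P (batch b c)) (range b)"

(* H i is the set of those distributions of the statistical model for which the i-th null
   hypothesis is true. *)
definition true_nulls :: "(nat \<Rightarrow> 'a measure set) \<Rightarrow> 'a measure \<Rightarrow> nat set" where
  "true_nulls H Pr = {i. Pr \<in> H i}"

definition valid_pvalues ::
  "'a measure \<Rightarrow> (nat \<Rightarrow> 'a \<Rightarrow> real) \<Rightarrow> nat set \<Rightarrow> bool" where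
  "valid_pvalues Pr P I0 \<longleftrightarrow>
     (\<forall>i\<in>I0. \<forall>x\<in>{0..1}. measure Pr {\<omega> \<in> space Pr. P i \<omega> \<le> x} \<le> x)"

(* Q is the distribution under the global null. *)
definition subset_pivotality ::
  "'a measure set \<Rightarrow> (nat \<Rightarrow> 'a measure set) \<Rightarrow> 'a measure \<Rightarrow> (nat \<Rightarrow> 'a \<Rightarrow> real) \<Rightarrow> bool" where
  "subset_pivotality Model H Q P \<longleftrightarrow>
     (\<forall>I. \<forall>Pr \<in> Model \<inter> (\<Inter>i\<in>I. H i).
        distr Pr (PiM I (\<lambda>_. borel)) (pvalue_vector P I) =
        distr Q (PiM I (\<lambda>_. borel)) (pvalue_vector P I))"

definition FWER ::
  "'a measure \<Rightarrow> nat set \<Rightarrow> (nat \<Rightarrow> 'a \<Rightarrow> real) \<Rightarrow> (nat \<Rightarrow> 'a \<Rightarrow> real) \<Rightarrow> real" where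
  "FWER Pr I0 P lev = measure Pr {\<omega> \<in> space Pr. \<exists>i\<in>I0. P i \<omega> \<le> lev i \<omega>}"

(* The conditional probability behind the correction, with the index set K and the levels a held
   fixed: the levels of a batch are determined by the earlier batches, and the batch is independent
   of those, so conditioning amounts to evaluating this function at the observed K and levels. *)
definition null_prob ::
  "'a measure \<Rightarrow> (nat \<Rightarrow> 'a \<Rightarrow> real) \<Rightarrow> nat set \<Rightarrow> (nat \<Rightarrow> real) \<Rightarrow> nat \<Rightarrow> real" where
  "null_prob Q P K a j =
     measure Q {\<omega> \<in> space Q. (\<forall>k\<in>K. P k \<omega> > a k) \<and> P j \<omega> \<le> a j}"

lemma null_prob_cong [fundef_cong]:
  assumes "K = K'" "j = j'" "\<And>k. k \<in> insert j' K' \<Longrightarrow> a k = a' k"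
  shows "null_prob Q P K a j = null_prob Q P K' a' j'"
  using assms by (simp add: null_prob_def cong: conj_cong ball_cong)

context
  fixes Q :: "'a measure"
    and P :: "nat \<Rightarrow> 'a \<Rightarrow> real"
    and b :: "nat \<Rightarrow> nat"
    and lam :: "nat \<Rightarrow> 'a \<Rightarrow> real"
    and \<gamma> :: "nat \<Rightarrow> 'a \<Rightarrow> real"
    and g :: "nat \<Rightarrow> nat \<Rightarrow> 'a \<Rightarrow> real"
    and \<alpha> :: real
begin

definition cand :: "nat \<Rightarrow> 'a \<Rightarrow> real" where
  "cand i \<omega> = of_bool (P i \<omega> \<le> lam (b i) \<omega>)"

(* For nondecreasing b the condition j < i is implied by b j < b i; it only serves to make the
   recursion well-founded for arbitrary b. *)
function graph_level :: "nat \<Rightarrow> 'a \<Rightarrow> real" where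
  "graph_level i \<omega> = (1 - lam (b i) \<omega>) *
     (\<alpha> * \<gamma> i \<omega>
      + (\<Sum>j\<in>{j. j < i \<and> b j < b i}.
           g j i \<omega> * cand j \<omega> * (graph_level j \<omega> / (1 - lam (b j) \<omega>)))
      + (\<Sum>j\<in>{j. j < i \<and> b j < b i}.
           g j i \<omega> * (1 - cand j \<omega>) *
             ((graph_level j \<omega>
               - null_prob Q P {k \<in> batch b (b j). k < j \<and> cand k \<omega> = 0}
                   (\<lambda>k. graph_level k \<omega>) j)
              / (1 - lam (b j) \<omega>))))"
  by pat_completeness auto
termination
  by (relation "inv_image less_than fst") auto

definition corr_level :: "nat \<Rightarrow> 'a \<Rightarrow> real" where
  "corr_level j \<omega> =
     null_prob Q P {k \<in> batch b (b j). k < j \<and> cand k \<omega> = 0} (\<lambda>k. graph_level k \<omega>) j"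

end

declare graph_level.simps [simp del]

end

theory Submission
  imports Defs
begin

text \<open>
  Write $w_i = \alpha_i / (1 - \lambda_{b_i})$ and let $s_i$ be the $i$-th summand of the budget sum.
  The recursion says $w_i = \alpha\gamma_i + \sum_{j : b_j < b_i} g_{j,i} (w_j - s_j)$ with
  $w_j - s_j \ge 0$. Summing over $i \le n$ and exchanging sums gives
  $\sum_{i \le n} w_i \le \alpha + \sum_{j \le n} (w_j - s_j)$, that is,
  $\sum_{j \le n} s_j \le \alpha$.

  For the error rate, fix a batch and condition on the past, so that its levels become constants.
  Within the batch, the numerators of the $s_j$ add up to the null probability that an independent
  copy of the p-values hits its level at some non-candidate. The first true null hit by the copy is
  a non-candidate with conditional probability at least $1 - \lambda$. Hence, by pivotality, the
  conditional probability of a false rejection in the batch is at most the conditional expectation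
  of the $s_j$ of the batch. Summing over the batches bounds the error rate by $\alpha$.
\<close>

section \<open>Measures of sections and independent random variables\<close>

text \<open>This is the measurability half of Fubini's theorem, in predicate form. The null
  probability at random levels is the measure of such a section, which is how the corrections become
  measurable.\<close>

lemma measure_section_measurable:
  assumes "sigma_finite_measure Q"
    and "Measurable.pred (F \<Otimes>\<^sub>M Q) (\<lambda>p. R (fst p) (snd p))"
  shows "(\<lambda>x. measure Q {y \<in> space Q. R x y}) \<in> borel_measurable F"
proof -
  interpret sigma_finite_measure Q by fact
  let ?A = "{p \<in> space (F \<Otimes>\<^sub>M Q). R (fst p) (snd p)}"
  have "?A \<in> sets (F \<Otimes>\<^sub>M Q)"
    using assms(2) by (simp add: pred_def)
  then have "(\<lambda>x. emeasure Q (Pair x -` ?A)) \<in> borel_measurable F"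
    by (rule measurable_emeasure_Pair)
  then have "(\<lambda>x. measure Q (Pair x -` ?A)) \<in> borel_measurable F"
    unfolding measure_def by measurable
  moreover have "measure Q (Pair x -` ?A) = measure Q {y \<in> space Q. R x y}"
    if "x \<in> space F" for x
    by (rule arg_cong[where f = "measure Q"]) (use that in \<open>auto simp: space_pair_measure\<close>)
  ultimately show ?thesis
    by (simp cong: measurable_cong)
qed

text \<open>
  Unlike \<open>indep_var\<close>, the two random variables may take values in different types.
\<close>
definition (in prob_space) indep_rv ::
  "'b measure \<Rightarrow> ('a \<Rightarrow> 'b) \<Rightarrow> 'c measure \<Rightarrow> ('a \<Rightarrow> 'c) \<Rightarrow> bool" where
  "indep_rv S X T Y \<longleftrightarrow> random_variable S X \<and> random_variable T Y \<and>
    indep_set {X -` A \<inter> space M | A. A \<in> sets S} {Y -` B \<inter> space M | B. B \<in> sets T}"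

text \<open>Independence gives agreement on rectangles, and these determine the product of two
  sigma-finite measures.\<close>

lemma (in prob_space) indep_rv_distribution:
  assumes "indep_rv S X T Y"
  shows "distr M S X \<Otimes>\<^sub>M distr M T Y = distr M (S \<Otimes>\<^sub>M T) (\<lambda>\<omega>. (X \<omega>, Y \<omega>))"
proof -
  have X [measurable]: "X \<in> measurable M S" and Y [measurable]: "Y \<in> measurable M T"
    and ind: "indep_set {X -` A \<inter> space M | A. A \<in> sets S} {Y -` B \<inter> space M | B. B \<in> sets T}"
    using assms by (auto simp: indep_rv_def)
  interpret X: prob_space "distr M S X"
    by (rule prob_space_distr) fact
  interpret Y: prob_space "distr M T Y"
    by (rule prob_space_distr) fact
  show ?thesis
  proof (rule pair_measure_eqI)
    fix A B assume "A \<in> sets (distr M S X)" "B \<in> sets (distr M T Y)"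
    then have A [measurable]: "A \<in> sets S" and B [measurable]: "B \<in> sets T"
      by auto
    have "prob ((X -` A \<inter> space M) \<inter> (Y -` B \<inter> space M))
        = prob (X -` A \<inter> space M) * prob (Y -` B \<inter> space M)"
      using A B by (intro indep_setD[OF ind]) auto
    moreover have "(X -` A \<inter> space M) \<inter> (Y -` B \<inter> space M)
        = (\<lambda>\<omega>. (X \<omega>, Y \<omega>)) -` (A \<times> B) \<inter> space M"
      by auto
    ultimately show "emeasure (distr M S X) A * emeasure (distr M T Y) B
        = emeasure (distr M (S \<Otimes>\<^sub>M T) (\<lambda>\<omega>. (X \<omega>, Y \<omega>))) (A \<times> B)"
      by (simp add: emeasure_distr emeasure_eq_measure ennreal_mult')
  qed (rule X.sigma_finite_measure_axioms Y.sigma_finite_measure_axioms | simp)+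
qed

text \<open>Stands in for conditioning on \<open>X\<close>: the inner integral averages over an
  independent copy of \<open>Y\<close> while \<open>X\<close> is held fixed. Once the joint law is
  known to be the product law, this is Tonelli's theorem.\<close>

lemma (in prob_space) nn_integral_indep_rv:
  assumes ind: "indep_rv S X T Y" and h: "h \<in> borel_measurable (S \<Otimes>\<^sub>M T)"
  shows "(\<integral>\<^sup>+\<omega>. h (X \<omega>, Y \<omega>) \<partial>M) = (\<integral>\<^sup>+\<omega>. (\<integral>\<^sup>+\<omega>'. h (X \<omega>, Y \<omega>') \<partial>M) \<partial>M)"
proof -
  have X [measurable]: "X \<in> measurable M S" and Y [measurable]: "Y \<in> measurable M T"
    using ind by (auto simp: indep_rv_def)
  note h [measurable]
  interpret Y: prob_space "distr M T Y"
    by (rule prob_space_distr) fact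
  have hd: "h \<in> borel_measurable (distr M S X \<Otimes>\<^sub>M distr M T Y)"
    by simp
  have "(\<integral>\<^sup>+\<omega>. h (X \<omega>, Y \<omega>) \<partial>M)
      = (\<integral>\<^sup>+p. h p \<partial>distr M (S \<Otimes>\<^sub>M T) (\<lambda>\<omega>. (X \<omega>, Y \<omega>)))"
    by (simp add: nn_integral_distr)
  also have "\<dots> = (\<integral>\<^sup>+p. h p \<partial>(distr M S X \<Otimes>\<^sub>M distr M T Y))"
    using ind by (simp add: indep_rv_distribution)
  also have "\<dots> = (\<integral>\<^sup>+x. (\<integral>\<^sup>+y. h (x, y) \<partial>distr M T Y) \<partial>distr M S X)"
    by (rule Y.nn_integral_fst[OF hd, symmetric])
  also have "\<dots> = (\<integral>\<^sup>+\<omega>. (\<integral>\<^sup>+y. h (X \<omega>, y) \<partial>distr M T Y) \<partial>M)"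
    by (rule nn_integral_distr[OF X]) measurable
  also have "\<dots> = (\<integral>\<^sup>+\<omega>. (\<integral>\<^sup>+\<omega>'. h (X \<omega>, Y \<omega>') \<partial>M) \<partial>M)"
    by (intro nn_integral_cong nn_integral_distr[OF Y]) measurable
  finally show ?thesis .
qed

section \<open>The past and its independence of the current batch\<close>

lemma space_past_algebra [simp]: "space (past_algebra M P b c) = space M"
  by (simp add: past_algebra_def space_measure_of_conv)

lemma sets_past_algebra:
  "sets (past_algebra M P b c) =
    sigma_sets (space M) (\<Union>j\<in>{j. b j < c}. {P j -` A \<inter> space M | A. A \<in> sets borel})"
  unfolding past_algebra_def by (rule sets_measure_of) auto

lemma subalgebra_past_algebra_mono:
  assumes "c \<le> c'"
  shows "subalgebra (past_algebra M P b c') (past_algebra M P b c)"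
  unfolding subalgebra_def sets_past_algebra space_past_algebra
  using assms by (intro conjI refl sigma_sets_mono' UN_mono) auto

lemma subalgebra_past_algebra:
  assumes "\<And>i. P i \<in> borel_measurable M"
  shows "subalgebra M (past_algebra M P b c)"
  unfolding subalgebra_def sets_past_algebra space_past_algebra
  using assms by (intro conjI refl sets.sigma_sets_subset) (auto intro: measurable_sets)

lemma measurable_past_algebra:
  assumes "b j < c"
  shows "P j \<in> borel_measurable (past_algebra M P b c)"
proof (rule measurableI)
  fix A :: "real set" assume "A \<in> sets borel"
  then show "P j -` A \<inter> space (past_algebra M P b c) \<in> sets (past_algebra M P b c)"
    unfolding sets_past_algebra space_past_algebra
    using assms by (intro sigma_sets.Basic) auto
qed simp

text \<open>The past enters as the identity map into the coarser sigma-algebra, so that holding this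
  variable fixed turns every past-measurable quantity into a constant. Independence holds because
  disjoint groups of independent batches, here all batches before \<open>c\<close> and
  \<open>c\<close> alone, generate independent sigma-algebras.\<close>

lemma (in prob_space) indep_rv_past_algebra:
  assumes ind: "batches_independent M P b"
    and P [measurable]: "\<And>i. P i \<in> borel_measurable M"
    and c: "c \<in> range b"
  shows "indep_rv (past_algebra M P b c) (\<lambda>\<omega>. \<omega>)
    (PiM (batch b c) (\<lambda>_. borel)) (pvalue_vector P (batch b c))"
proof -
  let ?N = "\<lambda>c. PiM (batch b c) (\<lambda>_. borel :: real measure)"
  let ?Y = "\<lambda>c. pvalue_vector P (batch b c)"
  let ?E = "\<lambda>c. {?Y c -` A \<inter> space M | A. A \<in> sets (?N c)}"
  let ?G = "\<lambda>c. sigma_sets (space M) (?E c)"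
  \<comment> \<open>The two groups are indexed by a truth value: \<open>True\<close> for the earlier
    batches, \<open>False\<close> for the current one.\<close>
  let ?I = "\<lambda>past. if past then {c' \<in> range b. c' < c} else {c}"
  have Y [measurable]: "?Y c \<in> measurable M (?N c)" for c
    unfolding pvalue_vector_def by measurable
  have E_sub: "?E c \<subseteq> Pow (space M)" for c
    by auto
  have indE: "indep_sets ?G (range b)"
    using ind unfolding batches_independent_def indep_vars_def by (rule conjunct2)
  have U: "(\<Union>past\<in>UNIV. ?I past) \<subseteq> range b"
    using c by (auto simp: UNIV_bool)
  have "indep_sets (\<lambda>past. sigma_sets (space M) (\<Union>c'\<in>?I past. ?G c')) UNIV"
  proof (rule indep_sets_collect_sigma)
    show "indep_sets ?G (\<Union>past\<in>UNIV. ?I past)"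
      by (rule indep_sets_mono_index[OF U indE])
    show "Int_stable (?G c')" if "past \<in> UNIV" "c' \<in> ?I past" for past c'
    proof (rule Int_stableI)
      interpret G: sigma_algebra "space M" "?G c'"
        by (rule sigma_algebra_sigma_sets[OF E_sub])
      show "A \<inter> B \<in> ?G c'" if "A \<in> ?G c'" "B \<in> ?G c'" for A B
        using that by (rule G.Int)
    qed
    show "disjoint_family_on ?I UNIV"
      by (auto simp: disjoint_family_on_def)
  qed
  moreover have "{(\<lambda>\<omega>. \<omega>) -` A \<inter> space M | A. A \<in> sets (past_algebra M P b c)}
      \<subseteq> sigma_sets (space M) (\<Union>c'\<in>?I True. ?G c')"
  proof safe
    fix A assume "A \<in> sets (past_algebra M P b c)"
    \<comment> \<open>An event about \<open>P j\<close> is an event about coordinate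
      \<open>j\<close> of the vector of its batch, so the generators of the past lie in the
      sigma-algebras of the earlier batches.\<close>
    moreover have E: "P j -` B \<inter> space M \<in> ?E (b j)" if "B \<in> sets borel" for j B
    proof -
      have "P j -` B \<inter> space M
          = ?Y (b j) -` ((\<lambda>y. y j) -` B \<inter> space (?N (b j))) \<inter> space M"
        by (auto simp: pvalue_vector_def batch_def space_PiM)
      moreover have "(\<lambda>y. y j) -` B \<inter> space (?N (b j)) \<in> sets (?N (b j))"
        using that by (intro measurable_sets[OF measurable_component_singleton])
          (auto simp: batch_def)
      ultimately show ?thesis
        by blast
    qed
    have "(\<Union>j\<in>{j. b j < c}. {P j -` B \<inter> space M | B. B \<in> sets borel})
        \<subseteq> (\<Union>c'\<in>?I True. ?G c')"
      (is "?A \<subseteq> ?B")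
    proof (intro subsetI)
      fix X assume "X \<in> ?A"
      then obtain j B where j: "b j < c" and X: "X = P j -` B \<inter> space M" "B \<in> sets borel"
        by auto
      have "X \<in> ?G (b j)"
        unfolding X(1) by (rule sigma_sets.Basic) (rule E[OF X(2)])
      then show "X \<in> ?B"
        using j by (intro UN_I[of "b j"]) auto
    qed
    then have "sets (past_algebra M P b c) \<subseteq> sigma_sets (space M) (\<Union>c'\<in>?I True. ?G c')"
      unfolding sets_past_algebra by (rule sigma_sets_mono')
    ultimately have "A \<in> sigma_sets (space M) (\<Union>c'\<in>?I True. ?G c')"
      by blast
    moreover have "A \<subseteq> space M"
      using sets.sets_into_space[OF \<open>A \<in> sets (past_algebra M P b c)\<close>] by simp
    ultimately show "(\<lambda>\<omega>. \<omega>) -` A \<inter> space M \<in> sigma_sets (space M) (\<Union>c'\<in>?I True. ?G c')"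
      by (simp add: Int_absorb2)
  qed
  moreover have "?E c \<subseteq> sigma_sets (space M) (\<Union>c'\<in>?I False. ?G c')"
    by (auto intro: sigma_sets.Basic)
  ultimately have "indep_set
      {(\<lambda>\<omega>. \<omega>) -` A \<inter> space M | A. A \<in> sets (past_algebra M P b c)} (?E c)"
    unfolding indep_set_def by (elim indep_sets_mono_sets) (auto split: bool.split)
  moreover have "(\<lambda>\<omega>. \<omega>) \<in> measurable M (past_algebra M P b c)"
    by (rule measurable_from_subalg[OF subalgebra_past_algebra measurable_ident_sets]) simp_all
  ultimately show ?thesis
    using Y by (simp add: indep_rv_def)
qed

section \<open>Decomposition by the first hit\<close>

text \<open>An outcome with some hit in \<open>J\<close> has a smallest index that hits, and the
  summands are the probabilities of the disjoint events that this index is \<open>j\<close>. It is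
  applied to the true nulls of a batch, to its non-candidates, and to the indices that are
  both.\<close>

lemma sum_null_prob_first_hit:
  assumes "finite_measure Q" "finite J" and [measurable]: "\<And>k. P k \<in> borel_measurable Q"
  shows "(\<Sum>j\<in>J. null_prob Q P {k \<in> J. k < j} a j)
    = measure Q {\<omega> \<in> space Q. \<exists>j\<in>J. P j \<omega> \<le> a j}"
proof -
  interpret finite_measure Q by fact
  let ?D = "\<lambda>j. {\<omega> \<in> space Q. (\<forall>k\<in>{k \<in> J. k < j}. P k \<omega> > a k) \<and> P j \<omega> \<le> a j}"
  have "\<exists>i\<in>J. (\<forall>k\<in>J. k < i \<longrightarrow> P k \<omega> > a k) \<and> P i \<omega> \<le> a i"
    if "j \<in> J" "P j \<omega> \<le> a j" for j \<omega>
    using that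
  proof (induction j rule: less_induct)
    case (less j)
    then show ?case
      by (cases "\<forall>k\<in>J. k < j \<longrightarrow> P k \<omega> > a k") (auto simp: not_less)
  qed
  then have "{\<omega> \<in> space Q. \<exists>j\<in>J. P j \<omega> \<le> a j} = (\<Union>j\<in>J. ?D j)"
    by fastforce
  moreover have "measure Q (\<Union>j\<in>J. ?D j) = (\<Sum>j\<in>J. measure Q (?D j))"
  proof (rule finite_measure_finite_Union)
    show "?D ` J \<subseteq> sets Q"
    proof (intro image_subsetI)
      fix j
      have "finite {k \<in> J. k < j}"
        using \<open>finite J\<close> by simp
      note [measurable] = pred_intros_finite(3)[OF this]
      show "?D j \<in> sets Q"
        by measurable
    qed
    show "disjoint_family_on ?D J"
      unfolding disjoint_family_on_def
    proof (intro ballI impI)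
      fix i j assume "i \<in> J" "j \<in> J" "i \<noteq> j"
      then show "?D i \<inter> ?D j = {}"
        by (cases "i < j") (force simp: not_less)+
    qed
  qed fact
  ultimately show ?thesis
    by (simp add: null_prob_def)
qed

section \<open>The procedure and its recursion\<close>

text \<open>\<open>Q\<close> is the global null distribution, and \<open>M\<close> supplies the
  common space and sigma-algebra. The true distribution is not fixed here: the levels and the budget
  inequality are pointwise matters that involve probabilities under \<open>Q\<close> only.\<close>

locale corr_graph = Q: prob_space Q
  for Q :: "'a measure" +
  fixes M :: "'a measure"
    and P :: "nat \<Rightarrow> 'a \<Rightarrow> real"
    and b :: "nat \<Rightarrow> nat"
    and lam :: "nat \<Rightarrow> 'a \<Rightarrow> real"
    and \<gamma> :: "nat \<Rightarrow> 'a \<Rightarrow> real"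
    and g :: "nat \<Rightarrow> nat \<Rightarrow> 'a \<Rightarrow> real"
    and \<alpha> :: real
  assumes sets_Q: "sets Q = sets M"
    and P_meas [measurable]: "\<And>i. P i \<in> borel_measurable M"
    and valid_Q: "\<And>i x. x \<in> {0..1} \<Longrightarrow> measure Q {\<omega> \<in> space Q. P i \<omega> \<le> x} \<le> x"
    and mono_b: "mono b"
    and alpha_nonneg: "0 \<le> \<alpha>"
    and lam_range: "\<And>i \<omega>. \<omega> \<in> space M \<Longrightarrow> lam (b i) \<omega> \<in> {0..<1}"
    and lam_meas: "\<And>i. lam (b i) \<in> borel_measurable (past_algebra M P b (b i))"
    and \<gamma>_nonneg: "\<And>i \<omega>. \<omega> \<in> space M \<Longrightarrow> 0 \<le> \<gamma> i \<omega>"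
    and \<gamma>_sums: "\<And>\<omega>. \<omega> \<in> space M \<Longrightarrow> (\<lambda>i. \<gamma> i \<omega>) sums 1"
    and \<gamma>_meas: "\<And>i. \<gamma> i \<in> borel_measurable (past_algebra M P b (b i))"
    and g_nonneg: "\<And>j i \<omega>. \<omega> \<in> space M \<Longrightarrow> j < i \<Longrightarrow> 0 \<le> g j i \<omega>"
    and g_sum: "\<And>j \<omega>. \<omega> \<in> space M \<Longrightarrow>
      (\<lambda>i. g j i \<omega>) summable_on {i. b i > b j} \<and> (\<Sum>\<^sub>\<infinity>i\<in>{i. b i > b j}. g j i \<omega>) \<le> 1"
    and g_meas: "\<And>j i. j < i \<Longrightarrow> g j i \<in> borel_measurable (past_algebra M P b (b i))"
begin

abbreviation "past \<equiv> past_algebra M P b"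
abbreviation "C \<equiv> cand P b lam"
abbreviation "lev \<equiv> graph_level Q P b lam \<gamma> g \<alpha>"
abbreviation "corr \<equiv> corr_level Q P b lam \<gamma> g \<alpha>"

definition spent :: "nat \<Rightarrow> 'a \<Rightarrow> real" where
  "spent j \<omega> = corr j \<omega> / (1 - lam (b j) \<omega>) * (1 - C j \<omega>)"

lemma P_meas_Q [measurable]: "P i \<in> borel_measurable Q"
  using P_meas[of i] measurable_cong_sets[OF sets_Q refl] by blast

lemma past_mono: "c \<le> c' \<Longrightarrow> f \<in> measurable (past c) N \<Longrightarrow> f \<in> measurable (past c') N"
  by (rule measurable_from_subalg[OF subalgebra_past_algebra_mono])

lemma past_M: "f \<in> measurable (past c) N \<Longrightarrow> f \<in> measurable M N"
  by (rule measurable_from_subalg[OF subalgebra_past_algebra[OF P_meas]])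

lemma b_less_imp_less: "b j < b i \<Longrightarrow> j < i"
  using mono_b by (meson leD leI monoD)

text \<open>A candidate \<open>j\<close> passes on its whole weight
  \<open>lev j / (1 - lam (b j))\<close>, a non-candidate only what is left after the correction.
  Since \<open>spent j\<close> vanishes for candidates, one formula covers both cases.\<close>

lemma lev_eq:
  "lev i \<omega> = (1 - lam (b i) \<omega>) *
    (\<alpha> * \<gamma> i \<omega> + (\<Sum>j | b j < b i. g j i \<omega> * (lev j \<omega> / (1 - lam (b j) \<omega>) - spent j \<omega>)))"
proof -
  have "{j. j < i \<and> b j < b i} = {j. b j < b i}"
    using b_less_imp_less by auto
  moreover have "g j i \<omega> * C j \<omega> * (lev j \<omega> / (1 - lam (b j) \<omega>))
      + g j i \<omega> * (1 - C j \<omega>) * ((lev j \<omega> - corr j \<omega>) / (1 - lam (b j) \<omega>))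
      = g j i \<omega> * (lev j \<omega> / (1 - lam (b j) \<omega>) - spent j \<omega>)" for j
    by (simp add: spent_def diff_divide_distrib algebra_simps)
  ultimately show ?thesis
    by (subst graph_level.simps)
      (simp add: corr_level_def[symmetric] add.assoc flip: sum.distrib)
qed

section \<open>Measurability with respect to the past\<close>

lemma cand_meas:
  assumes "b j < c"
  shows "C j \<in> borel_measurable (past c)"
proof -
  have [measurable]: "P j \<in> borel_measurable (past c)"
    using assms by (rule measurable_past_algebra)
  have [measurable]: "lam (b j) \<in> borel_measurable (past c)"
    using assms by (intro past_mono[OF _ lam_meas]) simp
  show ?thesis
    unfolding cand_def[abs_def] by measurable
qed

text \<open>Both the index set and the levels depend on the outcome. Writing the set as a fixed
  finite \<open>B\<close> cut down by a predicate \<open>S\<close> turns the condition into a finite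
  conjunction of measurable implications on the product of the past with \<open>Q\<close>; the null
  probability is then the measure of a section.\<close>

lemma null_prob_meas:
  assumes "finite B" and S: "\<And>k. k \<in> B \<Longrightarrow> Measurable.pred (past c) (S k)"
    and lev: "\<And>k. k \<in> insert j B \<Longrightarrow> lev k \<in> borel_measurable (past c)"
  shows "(\<lambda>\<omega>. null_prob Q P {k \<in> B. S k \<omega>} (\<lambda>k. lev k \<omega>) j) \<in> borel_measurable (past c)"
proof -
  let ?R = "\<lambda>\<omega> \<omega>'. (\<forall>k\<in>B. S k \<omega> \<longrightarrow> lev k \<omega> < P k \<omega>') \<and> P j \<omega>' \<le> lev j \<omega>"
  have "Measurable.pred (past c \<Otimes>\<^sub>M Q) (\<lambda>p. S k (fst p) \<longrightarrow> lev k (fst p) < P k (snd p))"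
    if "k \<in> B" for k
  proof -
    have [measurable]: "lev k \<in> borel_measurable (past c)" "Measurable.pred (past c) (S k)"
      using that by (simp_all add: lev S)
    show ?thesis
      by measurable
  qed
  then have "Measurable.pred (past c \<Otimes>\<^sub>M Q)
      (\<lambda>p. \<forall>k\<in>B. S k (fst p) \<longrightarrow> lev k (fst p) < P k (snd p))"
    by (rule pred_intros_finite(3)[OF \<open>finite B\<close>])
  moreover have "Measurable.pred (past c \<Otimes>\<^sub>M Q) (\<lambda>p. P j (snd p) \<le> lev j (fst p))"
  proof -
    have [measurable]: "lev j \<in> borel_measurable (past c)"
      by (simp add: lev)
    show ?thesis
      by measurable
  qed
  ultimately have "Measurable.pred (past c \<Otimes>\<^sub>M Q) (\<lambda>p. ?R (fst p) (snd p))"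
    by (rule pred_intros_logic(3))
  then have "(\<lambda>\<omega>. measure Q {\<omega>' \<in> space Q. ?R \<omega> \<omega>'}) \<in> borel_measurable (past c)"
    by (rule measure_section_measurable[OF Q.sigma_finite_measure_axioms, where R = ?R])
  moreover have "(\<lambda>\<omega>. null_prob Q P {k \<in> B. S k \<omega>} (\<lambda>k. lev k \<omega>) j)
      = (\<lambda>\<omega>. measure Q {\<omega>' \<in> space Q. ?R \<omega> \<omega>'})"
    unfolding null_prob_def by (intro ext arg_cong[where f = "measure Q"]) auto
  ultimately show ?thesis
    by (simp only:)
qed

text \<open>The strict inequality \<open>b j < c\<close> is essential: which earlier members of the
  batch are non-candidates is decided by the p-values of batch \<open>b j\<close> itself. The
  levels, in contrast, are already known before that batch.\<close>

lemma corr_meas: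
  assumes "b j < c" and lev: "\<And>k. b k = b j \<Longrightarrow> k \<le> j \<Longrightarrow> lev k \<in> borel_measurable (past (b j))"
  shows "corr j \<in> borel_measurable (past c)"
proof -
  let ?B = "{k. b k = b j \<and> k < j}"
  have "(\<lambda>\<omega>. null_prob Q P {k \<in> ?B. C k \<omega> = 0} (\<lambda>k. lev k \<omega>) j) \<in> borel_measurable (past c)"
  proof (rule null_prob_meas)
    show "finite ?B"
      by (rule finite_subset[of _ "{..<j}"]) auto
    show "Measurable.pred (past c) (\<lambda>\<omega>. C k \<omega> = 0)" if "k \<in> ?B" for k
    proof -
      have [measurable]: "C k \<in> borel_measurable (past c)"
        using assms(1) that by (intro cand_meas) simp
      show ?thesis
        by measurable
    qed
    show "lev k \<in> borel_measurable (past c)" if "k \<in> insert j ?B" for k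
      by (rule past_mono[OF less_imp_le[OF assms(1)] lev]) (use that in auto)
  qed
  moreover have "corr j = (\<lambda>\<omega>. null_prob Q P {k \<in> ?B. C k \<omega> = 0} (\<lambda>k. lev k \<omega>) j)"
    unfolding corr_level_def
    by (intro ext arg_cong[where f = "\<lambda>K. null_prob Q P K _ j"]) (auto simp: batch_def)
  ultimately show ?thesis
    by (simp only:)
qed

text \<open>The recursion for \<open>lev i\<close> reaches back only to earlier batches, where
  levels, candidates and corrections are known. The induction is strong because
  \<open>corr j\<close> involves the levels of all earlier non-candidates in the batch of
  \<open>j\<close>.\<close>

lemma lev_meas: "lev i \<in> borel_measurable (past (b i))"
proof (induction i rule: less_induct)
  case (less i)
  have term_meas: "(\<lambda>\<omega>. g j i \<omega> * (lev j \<omega> / (1 - lam (b j) \<omega>) - spent j \<omega>))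
      \<in> borel_measurable (past (b i))" if "b j < b i" for j
  proof -
    have "j < i"
      using that by (rule b_less_imp_less)
    then have [measurable]: "g j i \<in> borel_measurable (past (b i))"
      by (rule g_meas)
    have [measurable]: "lev j \<in> borel_measurable (past (b i))"
      using that \<open>j < i\<close> by (intro past_mono[OF _ less.IH]) auto
    have [measurable]: "lam (b j) \<in> borel_measurable (past (b i))"
      using that by (intro past_mono[OF _ lam_meas]) auto
    have [measurable]: "C j \<in> borel_measurable (past (b i))"
      using that by (rule cand_meas)
    have "lev k \<in> borel_measurable (past (b j))" if "b k = b j" "k \<le> j" for k
      using less.IH[of k] that \<open>j < i\<close> by simp
    then have [measurable]: "corr j \<in> borel_measurable (past (b i))"
      using that by (intro corr_meas) auto
    show ?thesis
      unfolding spent_def by measurable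
  qed
  have "(\<lambda>\<omega>. \<Sum>j | b j < b i. g j i \<omega> * (lev j \<omega> / (1 - lam (b j) \<omega>) - spent j \<omega>))
      \<in> borel_measurable (past (b i))"
    by (rule borel_measurable_sum) (rule term_meas, simp)
  then show ?case
    unfolding lev_eq[of i, abs_def]
    by (intro borel_measurable_times borel_measurable_diff borel_measurable_add
        borel_measurable_const lam_meas \<gamma>_meas)
qed

section \<open>Nonnegativity and the budget inequality\<close>

lemma corr_nonneg: "0 \<le> corr j \<omega>"
  by (simp add: corr_level_def null_prob_def)

text \<open>The event is contained in a hit of \<open>P j\<close> alone. Validity covers thresholds
  in the unit interval; above 1 the bound is trivial.\<close>

lemma null_prob_le:
  assumes "0 \<le> a j"
  shows "null_prob Q P K a j \<le> a j"
proof (cases "a j \<le> 1")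
  case True
  have "null_prob Q P K a j \<le> measure Q {\<omega> \<in> space Q. P j \<omega> \<le> a j}"
    unfolding null_prob_def by (rule Q.finite_measure_mono) auto
  also have "\<dots> \<le> a j"
    using assms True by (intro valid_Q) simp
  finally show ?thesis .
next
  case False
  have "null_prob Q P K a j \<le> 1"
    by (simp add: null_prob_def)
  with False show ?thesis
    by linarith
qed

lemma spent_nonneg: "\<omega> \<in> space M \<Longrightarrow> 0 \<le> spent j \<omega>"
  using lam_range[of \<omega> j] corr_nonneg[of j \<omega>] by (simp add: spent_def cand_def)

text \<open>Nonnegativity of the level is a hypothesis because \<open>lev_nonneg\<close> uses this
  bound inside its induction.\<close>

lemma spent_le:
  assumes "\<omega> \<in> space M" "0 \<le> lev j \<omega>"
  shows "spent j \<omega> \<le> lev j \<omega> / (1 - lam (b j) \<omega>)"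
proof -
  have "corr j \<omega> \<le> lev j \<omega>"
    using assms(2) unfolding corr_level_def by (rule null_prob_le)
  then show ?thesis
    using lam_range[OF assms(1), of j] assms(2) by (simp add: spent_def cand_def divide_right_mono)
qed

lemma lev_nonneg:
  assumes "\<omega> \<in> space M"
  shows "0 \<le> lev i \<omega>"
proof (induction i rule: less_induct)
  case (less i)
  have "0 \<le> g j i \<omega> * (lev j \<omega> / (1 - lam (b j) \<omega>) - spent j \<omega>)" if "b j < b i" for j
  proof (rule mult_nonneg_nonneg)
    have "j < i"
      using that by (rule b_less_imp_less)
    then show "0 \<le> g j i \<omega>"
      by (rule g_nonneg[OF assms])
    show "0 \<le> lev j \<omega> / (1 - lam (b j) \<omega>) - spent j \<omega>"
      using spent_le[OF assms less.IH[OF \<open>j < i\<close>]] by simp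
  qed
  then have "0 \<le> (\<Sum>j | b j < b i. g j i \<omega> * (lev j \<omega> / (1 - lam (b j) \<omega>) - spent j \<omega>))"
    by (intro sum_nonneg) simp
  moreover have "0 \<le> \<alpha> * \<gamma> i \<omega>"
    using alpha_nonneg \<gamma>_nonneg[OF assms] by (rule mult_nonneg_nonneg)
  moreover have "0 \<le> 1 - lam (b i) \<omega>"
    using lam_range[OF assms, of i] by simp
  ultimately show ?case
    unfolding lev_eq[of i] by (intro mult_nonneg_nonneg[OF _ add_nonneg_nonneg])
qed

lemma g_finite_sum_le:
  assumes "\<omega> \<in> space M" "finite A" "A \<subseteq> {i. b j < b i}"
  shows "(\<Sum>i\<in>A. g j i \<omega>) \<le> 1"
proof -
  have "(\<Sum>i\<in>A. g j i \<omega>) \<le> (\<Sum>\<^sub>\<infinity>i\<in>{i. b j < b i}. g j i \<omega>)"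
  proof (rule finite_sum_le_infsum)
    show "0 \<le> g j i \<omega>" if "i \<in> {i. b j < b i} - A" for i
      using that by (intro g_nonneg[OF assms(1)]) (auto dest: b_less_imp_less)
  qed (use g_sum[OF assms(1), of j] assms(2,3) in simp_all)
  then show ?thesis
    using g_sum[OF assms(1), of j] by linarith
qed

lemma sum_spent_le:
  assumes \<omega>: "\<omega> \<in> space M"
  shows "(\<Sum>j\<le>n. spent j \<omega>) \<le> \<alpha>"
proof -
  let ?w = "\<lambda>j. lev j \<omega> / (1 - lam (b j) \<omega>)"
  let ?r = "\<lambda>j. ?w j - spent j \<omega>"
  have r: "0 \<le> ?r j" for j
    using spent_le[OF \<omega> lev_nonneg[OF \<omega>]] by simp
  \<comment> \<open>For \<open>i\<close> up to \<open>n\<close>, every contributing \<open>j\<close>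
    is also at most \<open>n\<close>. Letting both indices run over the same square prepares the
    exchange of sums.\<close>
  have w: "?w i = \<alpha> * \<gamma> i \<omega> + (\<Sum>j\<le>n. if b j < b i then g j i \<omega> * ?r j else 0)" if "i \<le> n" for i
  proof -
    have "{j. b j < b i} = {j \<in> {..n}. b j < b i}"
      using that b_less_imp_less by fastforce
    then show ?thesis
      using lam_range[OF \<omega>, of i] by (subst lev_eq) (simp flip: sum.inter_filter)
  qed
  have "(\<Sum>i\<le>n. ?w i)
      = (\<Sum>i\<le>n. \<alpha> * \<gamma> i \<omega> + (\<Sum>j\<le>n. if b j < b i then g j i \<omega> * ?r j else 0))"
    by (intro sum.cong w) simp_all
  then have "(\<Sum>i\<le>n. ?w i)
      = \<alpha> * (\<Sum>i\<le>n. \<gamma> i \<omega>) + (\<Sum>i\<le>n. \<Sum>j\<le>n. if b j < b i then g j i \<omega> * ?r j else 0)"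
    by (simp only: sum.distrib sum_distrib_left)
  moreover have "(\<Sum>i\<le>n. \<Sum>j\<le>n. if b j < b i then g j i \<omega> * ?r j else 0)
      = (\<Sum>j\<le>n. (\<Sum>i | i \<le> n \<and> b j < b i. g j i \<omega>) * ?r j)"
  proof (subst sum.swap, rule sum.cong[OF refl])
    fix j
    have "(\<Sum>i\<le>n. if b j < b i then g j i \<omega> * ?r j else 0)
        = (\<Sum>i | i \<in> {..n} \<and> b j < b i. g j i \<omega> * ?r j)"
      by (rule sum.inter_filter[symmetric]) simp
    then show "(\<Sum>i\<le>n. if b j < b i then g j i \<omega> * ?r j else 0)
        = (\<Sum>i | i \<le> n \<and> b j < b i. g j i \<omega>) * ?r j"
      by (simp only: sum_distrib_right atMost_iff)
  qed
  \<comment> \<open>The remainder \<open>?r j\<close> is nonnegative and the weights leaving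
    \<open>j\<close> sum to at most 1, so no more than the remainder is passed on.\<close>
  moreover have "(\<Sum>j\<le>n. (\<Sum>i | i \<le> n \<and> b j < b i. g j i \<omega>) * ?r j) \<le> (\<Sum>j\<le>n. 1 * ?r j)"
    by (rule sum_mono, rule mult_right_mono[OF g_finite_sum_le[OF \<omega>] r]) auto
  moreover have "\<alpha> * (\<Sum>i\<le>n. \<gamma> i \<omega>) \<le> \<alpha> * 1"
  proof (rule mult_left_mono[OF _ alpha_nonneg])
    have "(\<Sum>i\<le>n. \<gamma> i \<omega>) \<le> (\<Sum>i. \<gamma> i \<omega>)"
      using sums_summable[OF \<gamma>_sums[OF \<omega>]]
      by (rule sum_le_suminf) (simp_all add: \<gamma>_nonneg[OF \<omega>])
    then show "(\<Sum>i\<le>n. \<gamma> i \<omega>) \<le> 1"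
      using sums_unique[OF \<gamma>_sums[OF \<omega>]] by simp
  qed
  \<comment> \<open>The total weight now stands on both sides and cancels, leaving the bound on what
    is spent.\<close>
  moreover have "(\<Sum>j\<le>n. 1 * ?r j) = (\<Sum>i\<le>n. ?w i) - (\<Sum>j\<le>n. spent j \<omega>)"
    by (simp add: sum_subtractf)
  ultimately show ?thesis
    by linarith
qed

section \<open>False rejections within one batch\<close>

lemma spent_meas: "spent j \<in> borel_measurable M"
proof -
  have [measurable]: "corr j \<in> borel_measurable M"
    by (rule past_M[OF corr_meas[OF lessI]]) (metis lev_meas)
  have [measurable]: "lam (b j) \<in> borel_measurable M" "C j \<in> borel_measurable M"
    by (rule past_M[OF lam_meas] past_M[OF cand_meas[OF lessI]])+
  show ?thesis
    unfolding spent_def by measurable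
qed

lemma null_prob_antimono:
  assumes "K \<subseteq> K'" "finite K"
  shows "null_prob Q P K' a j \<le> null_prob Q P K a j"
  unfolding null_prob_def
proof (rule Q.finite_measure_mono)
  note [measurable] = pred_intros_finite(3)[OF assms(2)]
  show "{\<omega> \<in> space Q. (\<forall>k\<in>K. a k < P k \<omega>) \<and> P j \<omega> \<le> a j} \<in> sets Q"
    by measurable
qed (use assms(1) in auto)

text \<open>The factor \<open>1 / (1 - lam c)\<close> is common to the batch, so only numerators
  matter. On the left, first hits among the true nulls are counted at non-candidates; they add up to
  at most the null probability that some true non-candidate hits. On the right, the corrections add
  up to the null probability that any non-candidate hits. The cut-off \<open>n\<close> keeps the
  sets finite, as the last batch may be infinite.\<close>

lemma sum_first_hit_le_sum_spent:
  fixes c n I0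
  defines "J \<equiv> {j \<in> I0. j \<le> n \<and> b j = c}"
  assumes \<omega>: "\<omega> \<in> space M" and c: "c \<in> range b"
  shows "(\<Sum>j\<in>J. null_prob Q P {k \<in> J. k < j} (\<lambda>k. lev k \<omega>) j * ((1 - C j \<omega>) / (1 - lam (b j) \<omega>)))
    \<le> (\<Sum>j\<in>{j \<in> {..n}. b j = c}. spent j \<omega>)"
proof -
  let ?a = "\<lambda>k. lev k \<omega>" and ?l = "1 - lam c \<omega>"
  let ?B = "{j \<in> {..n}. b j = c}"
  let ?S = "{j \<in> ?B. C j \<omega> = 0}"
  have C: "1 - C j \<omega> = of_bool (C j \<omega> = 0)" for j
    by (simp add: cand_def)
  have fin: "finite J" "finite ?B"
    by (auto simp: J_def)
  obtain i where "c = b i"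
    using c by blast
  then have l: "0 \<le> ?l"
    using lam_range[OF \<omega>, of i] by simp
  have "(\<Sum>j\<in>J. null_prob Q P {k \<in> J. k < j} ?a j * ((1 - C j \<omega>) / (1 - lam (b j) \<omega>)))
      = (\<Sum>j\<in>J. if C j \<omega> = 0 then null_prob Q P {k \<in> J. k < j} ?a j / ?l else 0)"
    unfolding C by (rule sum.cong) (auto simp: J_def)
  also have "\<dots> = (\<Sum>j\<in>{j \<in> J. C j \<omega> = 0}. null_prob Q P {k \<in> J. k < j} ?a j) / ?l"
    using fin by (simp add: sum.inter_filter[symmetric] sum_divide_distrib)
  finally have lhs: "(\<Sum>j\<in>J. null_prob Q P {k \<in> J. k < j} ?a j * ((1 - C j \<omega>) / (1 - lam (b j) \<omega>)))
      = (\<Sum>j\<in>{j \<in> J. C j \<omega> = 0}. null_prob Q P {k \<in> J. k < j} ?a j) / ?l" .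
  have "(\<Sum>j\<in>?B. spent j \<omega>) = (\<Sum>j\<in>?B. if C j \<omega> = 0 then corr j \<omega> / ?l else 0)"
    unfolding spent_def C by (rule sum.cong) auto
  also have "\<dots> = (\<Sum>j\<in>?S. corr j \<omega>) / ?l"
    using fin by (simp add: sum.inter_filter[symmetric] sum_divide_distrib)
  finally have rhs: "(\<Sum>j\<in>?B. spent j \<omega>) = (\<Sum>j\<in>?S. corr j \<omega>) / ?l" .
  txt \<open>Dropping the candidates from the set of earlier true nulls only enlarges each first-hit event.\<close>
  have "(\<Sum>j\<in>{j \<in> J. C j \<omega> = 0}. null_prob Q P {k \<in> J. k < j} ?a j)
      \<le> (\<Sum>j\<in>{j \<in> J. C j \<omega> = 0}. null_prob Q P {k \<in> {j \<in> J. C j \<omega> = 0}. k < j} ?a j)"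
    using fin by (intro sum_mono null_prob_antimono) auto
  also have "\<dots> = measure Q {\<omega>' \<in> space Q. \<exists>j\<in>{j \<in> J. C j \<omega> = 0}. P j \<omega>' \<le> ?a j}"
    using fin by (intro sum_null_prob_first_hit Q.finite_measure_axioms) auto
  also have "\<dots> \<le> measure Q {\<omega>' \<in> space Q. \<exists>j\<in>?S. P j \<omega>' \<le> ?a j}"
  proof (rule Q.finite_measure_mono)
    have "finite ?S"
      by simp
    note [measurable] = pred_intros_finite(4)[OF this]
    show "{\<omega>' \<in> space Q. \<exists>j\<in>?S. P j \<omega>' \<le> ?a j} \<in> sets Q"
      by measurable
  qed (auto simp: J_def)
  also have "\<dots> = (\<Sum>j\<in>?S. null_prob Q P {k \<in> ?S. k < j} ?a j)"
    using fin by (intro sum_null_prob_first_hit[symmetric] Q.finite_measure_axioms) auto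
  \<comment> \<open>Every \<open>k < j\<close> is at most \<open>n\<close> as well, so the cut-off
    does not change the index set inside \<open>corr j\<close>.\<close>
  also have "\<dots> = (\<Sum>j\<in>?S. corr j \<omega>)"
    unfolding corr_level_def
    by (intro sum.cong refl arg_cong[where f = "\<lambda>K. null_prob Q P K ?a _"])
      (auto simp: batch_def)
  finally have "(\<Sum>j\<in>{j \<in> J. C j \<omega> = 0}. null_prob Q P {k \<in> J. k < j} ?a j) \<le> (\<Sum>j\<in>?S. corr j \<omega>)" .
  then show ?thesis
    unfolding lhs rhs using l by (rule divide_right_mono)
qed

text \<open>Decoupling is used twice. First it turns the hit probability into the mean of null
  probabilities at fixed levels. Then it brings in the candidate indicator, at the price of the
  factor \<open>1 / (1 - lam c)\<close>. What remains is the pointwise comparison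
  \<open>sum_first_hit_le_sum_spent\<close>.\<close>

lemma batch_hit_le_spent:
  fixes Pr :: "'a measure" and I0 :: "nat set" and c n :: nat
  defines "J \<equiv> {j \<in> I0. j \<le> n \<and> b j = c}"
  assumes "prob_space Pr" and sets_Pr: "sets Pr = sets M"
    and indep: "batches_independent Pr P b"
    and valid: "valid_pvalues Pr P I0"
    and pivotal: "distr Pr (PiM I0 (\<lambda>_. borel)) (pvalue_vector P I0)
      = distr Q (PiM I0 (\<lambda>_. borel)) (pvalue_vector P I0)"
    and c: "c \<in> range b"
  shows "emeasure Pr {\<omega> \<in> space Pr. \<exists>j\<in>J. P j \<omega> \<le> lev j \<omega>}
    \<le> (\<integral>\<^sup>+\<omega>. ennreal (\<Sum>j\<in>{j \<in> {..n}. b j = c}. spent j \<omega>) \<partial>Pr)"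
proof -
  interpret Pr: prob_space Pr by fact
  have space_Pr: "space Pr = space M"
    by (rule sets_eq_imp_space_eq) fact
  have meas_Pr: "f \<in> borel_measurable Pr" if "f \<in> borel_measurable M" for f :: "'a \<Rightarrow> real"
    using that by (simp add: measurable_cong_sets[OF sets_Pr refl])
  have [measurable]: "P j \<in> borel_measurable Pr" for j
    by (rule meas_Pr) (rule P_meas)
  \<comment> \<open>The past is determined by the space and the p-values, hence is the same for
    every distribution in question.\<close>
  have past_Pr: "past_algebra Pr P b c = past c"
    by (simp add: past_algebra_def space_Pr)
  have finJ: "finite J"
    by (simp add: J_def)
  let ?N = "PiM (batch b c) (\<lambda>_. borel :: real measure)"
  let ?Y = "pvalue_vector P (batch b c)"
  have decouple: "(\<integral>\<^sup>+\<omega>. h (\<omega>, ?Y \<omega>) \<partial>Pr) = (\<integral>\<^sup>+\<omega>. (\<integral>\<^sup>+\<omega>'. h (\<omega>, ?Y \<omega>') \<partial>Pr) \<partial>Pr)"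
    if "h \<in> borel_measurable (past c \<Otimes>\<^sub>M ?N)" for h
    using Pr.indep_rv_past_algebra[OF indep _ c] that
    by (intro Pr.nn_integral_indep_rv[of "past c" "\<lambda>\<omega>. \<omega>"]) (simp_all add: past_Pr)
  have Y: "?Y \<omega> j = P j \<omega>" if "j \<in> J" for \<omega> j
    using that by (simp add: pvalue_vector_def batch_def J_def)
  have lev_J [measurable]: "lev j \<in> borel_measurable (past c)" if "j \<in> J" for j
    using lev_meas[of j] that by (simp add: J_def)
  have comp: "(\<lambda>p. snd p j) \<in> borel_measurable (past c \<Otimes>\<^sub>M ?N)" if "j \<in> J" for j
    using that by (intro measurable_compose[OF measurable_snd measurable_component_singleton])
      (simp add: batch_def J_def)
  have lam_c [measurable]: "lam c \<in> borel_measurable (past c)"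
    using c lam_meas by auto
  txt \<open>The null probability that \<open>j\<close> is the first true null of the batch to hit its level.\<close>
  define q where "q j \<omega> = null_prob Q P {k \<in> J. k < j} (\<lambda>k. lev k \<omega>) j" for j \<omega>
  have q_meas [measurable]: "q j \<in> borel_measurable (past c)" if "j \<in> J" for j
    unfolding q_def[abs_def] using that by (intro null_prob_meas finJ lev_J) auto
  have q_nonneg: "0 \<le> q j \<omega>" for j \<omega>
    by (simp add: q_def null_prob_def)

  \<comment> \<open>At constant levels the event concerns the p-values of true nulls only, so
    pivotality moves it from \<open>Pr\<close> to \<open>Q\<close>.\<close>
  have pivot: "measure Pr {\<omega> \<in> space Pr. \<exists>j\<in>J. P j \<omega> \<le> a j}
      = measure Q {\<omega> \<in> space Q. \<exists>j\<in>J. P j \<omega> \<le> a j}" for a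
  proof -
    let ?NI = "PiM I0 (\<lambda>_. borel :: real measure)"
    let ?A = "{y \<in> space ?NI. \<exists>j\<in>J. y j \<le> a j}"
    have "J \<subseteq> I0"
      by (auto simp: J_def)
    have "Measurable.pred ?NI (\<lambda>y. y j \<le> a j)" if "j \<in> J" for j
    proof -
      have [measurable]: "(\<lambda>y. y j) \<in> borel_measurable ?NI"
        using that \<open>J \<subseteq> I0\<close> by (intro measurable_component_singleton) auto
      show ?thesis
        by measurable
    qed
    from pred_intros_finite(4)[OF finJ this] have A: "?A \<in> sets ?NI"
      by (simp add: pred_def)
    have vec: "measure R {\<omega> \<in> space R. \<exists>j\<in>J. P j \<omega> \<le> a j}
        = measure (distr R ?NI (pvalue_vector P I0)) ?A"
      if P: "\<And>i. P i \<in> borel_measurable R" for R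
    proof -
      have "pvalue_vector P I0 \<in> measurable R ?NI"
        unfolding pvalue_vector_def[abs_def] by (intro measurable_restrict P)
      moreover have "pvalue_vector P I0 -` ?A \<inter> space R = {\<omega> \<in> space R. \<exists>j\<in>J. P j \<omega> \<le> a j}"
        using \<open>J \<subseteq> I0\<close> by (auto simp: pvalue_vector_def space_PiM)
      ultimately show ?thesis
        using A by (simp add: measure_distr)
    qed
    show ?thesis
      by (simp add: vec pivotal)
  qed

  \<comment> \<open>The levels are frozen at \<omega> and only the copy \<omega>' varies, so
    \<open>pivot\<close> applies for each \<omega>.\<close>
  have hit: "emeasure Pr {\<omega>' \<in> space Pr. \<exists>j\<in>J. P j \<omega>' \<le> lev j \<omega>} = (\<Sum>j\<in>J. ennreal (q j \<omega>))"
    for \<omega>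
  proof -
    have "measure Pr {\<omega>' \<in> space Pr. \<exists>j\<in>J. P j \<omega>' \<le> lev j \<omega>} = (\<Sum>j\<in>J. q j \<omega>)"
      unfolding pivot q_def
      by (rule sum_null_prob_first_hit[OF Q.finite_measure_axioms finJ P_meas_Q, symmetric])
    then show ?thesis
      by (simp add: Pr.emeasure_eq_measure q_nonneg)
  qed

  have hit_sets: "{\<omega>' \<in> space Pr. \<exists>j\<in>J. P j \<omega>' \<le> a j \<omega>'} \<in> sets Pr"
    if "\<And>j. j \<in> J \<Longrightarrow> a j \<in> borel_measurable Pr" for a
  proof -
    have "Measurable.pred Pr (\<lambda>\<omega>'. P j \<omega>' \<le> a j \<omega>')" if "j \<in> J" for j
      using \<open>\<And>j. j \<in> J \<Longrightarrow> a j \<in> borel_measurable Pr\<close>[OF that, measurable] by measurable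
    from pred_intros_finite(4)[OF finJ this] show ?thesis
      by (simp add: pred_def)
  qed

  have "emeasure Pr {\<omega> \<in> space Pr. \<exists>j\<in>J. P j \<omega> \<le> lev j \<omega>} = (\<integral>\<^sup>+\<omega>. (\<Sum>j\<in>J. ennreal (q j \<omega>)) \<partial>Pr)"
  proof -
    \<comment> \<open>The hit event is lifted to pairs of a past outcome, which fixes the levels,
      and a vector of p-values of the batch. On the diagonal it is the original event; off it, the
      p-values come from an independent copy.\<close>
    let ?A = "{p \<in> space (past c \<Otimes>\<^sub>M ?N). \<exists>j\<in>J. snd p j \<le> lev j (fst p)}"
    have "Measurable.pred (past c \<Otimes>\<^sub>M ?N) (\<lambda>p. snd p j \<le> lev j (fst p))" if "j \<in> J" for j
      using comp[OF that, measurable] lev_J[OF that, measurable] by measurable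
    from pred_intros_finite(4)[OF finJ this] have A: "?A \<in> sets (past c \<Otimes>\<^sub>M ?N)"
      by (simp add: pred_def)
    have ind: "indicator ?A (\<omega>, ?Y \<omega>')
        = (indicator {\<omega>' \<in> space Pr. \<exists>j\<in>J. P j \<omega>' \<le> lev j \<omega>} \<omega>' :: ennreal)"
      if "\<omega> \<in> space Pr" "\<omega>' \<in> space Pr" for \<omega> \<omega>'
    proof -
      have "(\<omega>, ?Y \<omega>') \<in> space (past c \<Otimes>\<^sub>M ?N)"
        using that by (auto simp: space_pair_measure space_PiM space_Pr pvalue_vector_def)
      then show ?thesis
        using that by (auto simp: indicator_def Y)
    qed
    have "emeasure Pr {\<omega> \<in> space Pr. \<exists>j\<in>J. P j \<omega> \<le> lev j \<omega>}
        = (\<integral>\<^sup>+\<omega>. indicator {\<omega> \<in> space Pr. \<exists>j\<in>J. P j \<omega> \<le> lev j \<omega>} \<omega> \<partial>Pr)"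
      by (intro nn_integral_indicator[symmetric] hit_sets meas_Pr past_M[OF lev_meas])
    also have "\<dots> = (\<integral>\<^sup>+\<omega>. indicator ?A (\<omega>, ?Y \<omega>) \<partial>Pr)"
      by (rule nn_integral_cong) (subst ind, auto simp: indicator_def)
    also have "\<dots> = (\<integral>\<^sup>+\<omega>. (\<integral>\<^sup>+\<omega>'. indicator ?A (\<omega>, ?Y \<omega>') \<partial>Pr) \<partial>Pr)"
      by (rule decouple) (use A in simp)
    also have "\<dots> = (\<integral>\<^sup>+\<omega>. emeasure Pr {\<omega>' \<in> space Pr. \<exists>j\<in>J. P j \<omega>' \<le> lev j \<omega>} \<partial>Pr)"
    proof (rule nn_integral_cong)
      fix \<omega> assume "\<omega> \<in> space Pr"
      then have "(\<integral>\<^sup>+\<omega>'. indicator ?A (\<omega>, ?Y \<omega>') \<partial>Pr)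
          = (\<integral>\<^sup>+\<omega>'. indicator {\<omega>' \<in> space Pr. \<exists>j\<in>J. P j \<omega>' \<le> lev j \<omega>} \<omega>' \<partial>Pr)"
        by (intro nn_integral_cong ind)
      then show "(\<integral>\<^sup>+\<omega>'. indicator ?A (\<omega>, ?Y \<omega>') \<partial>Pr)
          = emeasure Pr {\<omega>' \<in> space Pr. \<exists>j\<in>J. P j \<omega>' \<le> lev j \<omega>}"
        using nn_integral_indicator[OF hit_sets[of "\<lambda>j _. lev j \<omega>"]] by simp
    qed
    finally show ?thesis
      by (simp only: hit)
  qed
  also have "\<dots> = (\<Sum>j\<in>J. \<integral>\<^sup>+\<omega>. ennreal (q j \<omega>) \<partial>Pr)"
    by (intro nn_integral_sum measurable_compose[OF _ measurable_ennreal] meas_Pr past_M[OF q_meas])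
  \<comment> \<open>By validity, an independent copy of \<open>P j\<close> exceeds
    \<open>lam c\<close> with probability at least \<open>1 - lam c\<close>. Inserting the indicator
    of this event divided by \<open>1 - lam c\<close> therefore cannot lower the mean, and
    decoupling in reverse replaces the copy by \<open>P j\<close> itself.\<close>
  also have "\<dots> \<le> (\<Sum>j\<in>J. \<integral>\<^sup>+\<omega>. ennreal (q j \<omega> * ((1 - C j \<omega>) / (1 - lam (b j) \<omega>))) \<partial>Pr)"
  proof (rule sum_mono)
    fix j assume j: "j \<in> J"
    then have bj: "b j = c" and "j \<in> I0"
      by (auto simp: J_def)
    note [measurable] = comp[OF j] q_meas[OF j]
    let ?h = "\<lambda>p. ennreal (q j (fst p) / (1 - lam c (fst p))) * of_bool (lam c (fst p) < snd p j)"
    have h: "?h \<in> borel_measurable (past c \<Otimes>\<^sub>M ?N)"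
      by measurable
    have "(\<integral>\<^sup>+\<omega>. ennreal (q j \<omega>) \<partial>Pr) \<le> (\<integral>\<^sup>+\<omega>. (\<integral>\<^sup>+\<omega>'. ?h (\<omega>, ?Y \<omega>') \<partial>Pr) \<partial>Pr)"
    proof (rule nn_integral_mono)
      fix \<omega> assume \<omega>: "\<omega> \<in> space Pr"
      let ?l = "lam c \<omega>"
      have l: "0 \<le> ?l" "?l < 1"
        using lam_range[of \<omega> j] \<omega> by (auto simp: bj space_Pr)
      have "measure Pr {\<omega>' \<in> space Pr. P j \<omega>' \<le> ?l} \<le> ?l"
        using valid \<open>j \<in> I0\<close> l by (auto simp: valid_pvalues_def)
      moreover have "measure Pr {\<omega>' \<in> space Pr. \<not> P j \<omega>' \<le> ?l}
          = 1 - measure Pr {\<omega>' \<in> space Pr. P j \<omega>' \<le> ?l}"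
        by (rule Pr.prob_neg) measurable
      ultimately have tail: "1 - ?l \<le> measure Pr {\<omega>' \<in> space Pr. ?l < P j \<omega>'}"
        by (simp add: not_le)
      have "ennreal (q j \<omega>) = ennreal (q j \<omega> / (1 - ?l)) * ennreal (1 - ?l)"
        using l q_nonneg[of j \<omega>] by (simp flip: ennreal_mult)
      also have "\<dots> \<le> ennreal (q j \<omega> / (1 - ?l)) * emeasure Pr {\<omega>' \<in> space Pr. ?l < P j \<omega>'}"
        unfolding Pr.emeasure_eq_measure by (intro mult_left_mono ennreal_leI tail) simp
      also have "\<dots> = (\<integral>\<^sup>+\<omega>'. ennreal (q j \<omega> / (1 - ?l))
          * indicator {\<omega>' \<in> space Pr. ?l < P j \<omega>'} \<omega>' \<partial>Pr)"
        by (rule nn_integral_cmult_indicator[symmetric]) measurable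
      also have "\<dots> = (\<integral>\<^sup>+\<omega>'. ?h (\<omega>, ?Y \<omega>') \<partial>Pr)"
        by (rule nn_integral_cong) (simp add: Y[OF j] indicator_def)
      finally show "ennreal (q j \<omega>) \<le> (\<integral>\<^sup>+\<omega>'. ?h (\<omega>, ?Y \<omega>') \<partial>Pr)" .
    qed
    also have "\<dots> = (\<integral>\<^sup>+\<omega>. ?h (\<omega>, ?Y \<omega>) \<partial>Pr)"
      by (rule decouple[OF h, symmetric])
    also have "\<dots> = (\<integral>\<^sup>+\<omega>. ennreal (q j \<omega> * ((1 - C j \<omega>) / (1 - lam (b j) \<omega>))) \<partial>Pr)"
      by (rule nn_integral_cong) (simp add: Y[OF j] bj cand_def not_le)
    finally show "(\<integral>\<^sup>+\<omega>. ennreal (q j \<omega>) \<partial>Pr)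
        \<le> (\<integral>\<^sup>+\<omega>. ennreal (q j \<omega> * ((1 - C j \<omega>) / (1 - lam (b j) \<omega>))) \<partial>Pr)" .
  qed
  also have "\<dots> = (\<integral>\<^sup>+\<omega>. (\<Sum>j\<in>J. ennreal (q j \<omega> * ((1 - C j \<omega>) / (1 - lam (b j) \<omega>)))) \<partial>Pr)"
  proof (rule nn_integral_sum[symmetric])
    fix j assume j: "j \<in> J"
    have [measurable]: "q j \<in> borel_measurable Pr" "C j \<in> borel_measurable Pr"
      "lam (b j) \<in> borel_measurable Pr"
      by (rule meas_Pr past_M[OF q_meas[OF j]] past_M[OF cand_meas[OF lessI]] past_M[OF lam_meas])+
    show "(\<lambda>\<omega>. ennreal (q j \<omega> * ((1 - C j \<omega>) / (1 - lam (b j) \<omega>)))) \<in> borel_measurable Pr"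
      by measurable
  qed
  also have "\<dots> \<le> (\<integral>\<^sup>+\<omega>. ennreal (\<Sum>j\<in>{j \<in> {..n}. b j = c}. spent j \<omega>) \<partial>Pr)"
  proof (rule nn_integral_mono)
    fix \<omega> assume "\<omega> \<in> space Pr"
    then have \<omega>: "\<omega> \<in> space M"
      by (simp add: space_Pr)
    have "0 \<le> (1 - C j \<omega>) / (1 - lam (b j) \<omega>)" for j
      using lam_range[OF \<omega>, of j] by (simp add: cand_def)
    then have "(\<Sum>j\<in>J. ennreal (q j \<omega> * ((1 - C j \<omega>) / (1 - lam (b j) \<omega>))))
        = ennreal (\<Sum>j\<in>J. q j \<omega> * ((1 - C j \<omega>) / (1 - lam (b j) \<omega>)))"
      by (intro sum_ennreal mult_nonneg_nonneg q_nonneg)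
    also have "\<dots> \<le> ennreal (\<Sum>j\<in>{j \<in> {..n}. b j = c}. spent j \<omega>)"
      using sum_first_hit_le_sum_spent[OF \<omega> c, of I0 n] unfolding q_def J_def by (rule ennreal_leI)
    finally show "(\<Sum>j\<in>J. ennreal (q j \<omega> * ((1 - C j \<omega>) / (1 - lam (b j) \<omega>))))
        \<le> ennreal (\<Sum>j\<in>{j \<in> {..n}. b j = c}. spent j \<omega>)" .
  qed
  finally show ?thesis .
qed

section \<open>The familywise error rate\<close>

text \<open>For indices up to \<open>n\<close>, a union bound over the finitely many batches
  involved reduces the claim to the batch bounds and the budget inequality. Continuity from below
  then removes the cut-off.\<close>

lemma FWER_le:
  fixes Pr :: "'a measure"
  assumes "prob_space Pr" and sets_Pr: "sets Pr = sets M"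
    and indep: "batches_independent Pr P b"
    and valid: "valid_pvalues Pr P I0"
    and pivotal: "distr Pr (PiM I0 (\<lambda>_. borel)) (pvalue_vector P I0)
      = distr Q (PiM I0 (\<lambda>_. borel)) (pvalue_vector P I0)"
  shows "FWER Pr I0 P lev \<le> \<alpha>"
proof -
  interpret Pr: prob_space Pr by fact
  have space_Pr: "space Pr = space M"
    by (rule sets_eq_imp_space_eq) fact
  have meas_Pr: "f \<in> borel_measurable Pr" if "f \<in> borel_measurable M" for f :: "'a \<Rightarrow> real"
    using that by (simp add: measurable_cong_sets[OF sets_Pr refl])
  have [measurable]: "P j \<in> borel_measurable Pr" "lev j \<in> borel_measurable Pr"
    "spent j \<in> borel_measurable Pr" for j
    by (rule meas_Pr P_meas past_M[OF lev_meas] spent_meas)+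
  let ?A = "\<lambda>n. {\<omega> \<in> space Pr. \<exists>j\<in>{j \<in> I0. j \<le> n}. P j \<omega> \<le> lev j \<omega>}"
  let ?J = "\<lambda>n c. {j \<in> I0. j \<le> n \<and> b j = c}"
  let ?B = "\<lambda>n c. {j \<in> {..n}. b j = c}"
  have hit_sets: "{\<omega> \<in> space Pr. \<exists>j\<in>J. P j \<omega> \<le> lev j \<omega>} \<in> sets Pr" for J
  proof -
    have "{\<omega> \<in> space Pr. \<exists>j\<in>J. P j \<omega> \<le> lev j \<omega>} = (\<Union>j\<in>J. {\<omega> \<in> space Pr. P j \<omega> \<le> lev j \<omega>})"
      by auto
    then show ?thesis
      by (simp add: sets.countable_UN'')
  qed
  have le: "measure Pr (?A n) \<le> \<alpha>" for n
  proof -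
    have "emeasure Pr (?A n)
        \<le> emeasure Pr (\<Union>c\<in>b ` {..n}. {\<omega> \<in> space Pr. \<exists>j\<in>?J n c. P j \<omega> \<le> lev j \<omega>})"
      by (intro emeasure_mono sets.finite_UN hit_sets) auto
    also have "\<dots> \<le> (\<Sum>c\<in>b ` {..n}. emeasure Pr {\<omega> \<in> space Pr. \<exists>j\<in>?J n c. P j \<omega> \<le> lev j \<omega>})"
      by (intro emeasure_subadditive_finite) (use hit_sets in auto)
    also have "\<dots> \<le> (\<Sum>c\<in>b ` {..n}. \<integral>\<^sup>+\<omega>. ennreal (\<Sum>j\<in>?B n c. spent j \<omega>) \<partial>Pr)"
      by (intro sum_mono batch_hit_le_spent assms) auto
    also have "\<dots> = (\<integral>\<^sup>+\<omega>. (\<Sum>c\<in>b ` {..n}. ennreal (\<Sum>j\<in>?B n c. spent j \<omega>)) \<partial>Pr)"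
      by (rule nn_integral_sum[symmetric]) measurable
    also have "\<dots> \<le> (\<integral>\<^sup>+\<omega>. ennreal \<alpha> \<partial>Pr)"
    proof (rule nn_integral_mono)
      fix \<omega> assume "\<omega> \<in> space Pr"
      then have \<omega>: "\<omega> \<in> space M"
        by (simp add: space_Pr)
      have "(\<Sum>c\<in>b ` {..n}. ennreal (\<Sum>j\<in>?B n c. spent j \<omega>))
          = ennreal (\<Sum>c\<in>b ` {..n}. \<Sum>j\<in>?B n c. spent j \<omega>)"
        by (intro sum_ennreal sum_nonneg spent_nonneg \<omega>)
      \<comment> \<open>The batches partition the indices up to \<open>n\<close>, so the batch sums
        reassemble into the budget sum, which is bounded for every outcome.\<close>
      also have "(\<Sum>c\<in>b ` {..n}. \<Sum>j\<in>?B n c. spent j \<omega>) = (\<Sum>j\<le>n. spent j \<omega>)"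
        by (rule sum.image_gen[symmetric]) simp
      finally show "(\<Sum>c\<in>b ` {..n}. ennreal (\<Sum>j\<in>?B n c. spent j \<omega>)) \<le> ennreal \<alpha>"
        using sum_spent_le[OF \<omega>] by (simp add: ennreal_leI)
    qed
    also have "\<dots> = ennreal \<alpha>"
      by (simp add: Pr.emeasure_space_1)
    finally show ?thesis
      using alpha_nonneg by (simp add: Pr.emeasure_eq_measure)
  qed
  have "(\<lambda>n. measure Pr (?A n)) \<longlonglongrightarrow> measure Pr (\<Union>n. ?A n)"
    by (rule Pr.finite_Lim_measure_incseq) (use hit_sets in \<open>fastforce simp: incseq_def\<close>)+
  moreover have "(\<Union>n. ?A n) = {\<omega> \<in> space Pr. \<exists>j\<in>I0. P j \<omega> \<le> lev j \<omega>}"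
    by auto
  ultimately have "(\<lambda>n. measure Pr (?A n)) \<longlonglongrightarrow> FWER Pr I0 P lev"
    by (simp add: FWER_def)
  then show ?thesis
    by (rule LIMSEQ_le_const2) (use le in blast)
qed

end

section \<open>Levels, budget and strong error control in the statistical model\<close>

theorem theoremB2:
  fixes M :: "'a measure"
    and Model :: "'a measure set"
    and H :: "nat \<Rightarrow> 'a measure set"
    and Q :: "'a measure"
    and P :: "nat \<Rightarrow> 'a \<Rightarrow> real"
    and b :: "nat \<Rightarrow> nat"
    and lam :: "nat \<Rightarrow> 'a \<Rightarrow> real"
    and \<gamma> :: "nat \<Rightarrow> 'a \<Rightarrow> real"
    and g :: "nat \<Rightarrow> nat \<Rightarrow> 'a \<Rightarrow> real"
    and \<alpha> :: real
  assumes model: "\<And>Pr. Pr \<in> Model \<Longrightarrow> prob_space Pr \<and> sets Pr = sets M"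
    and null_hypotheses: "\<And>i. H i \<subseteq> Model"
    and global_null: "Q \<in> (\<Inter>i. H i)"
    and pvalue_meas: "\<And>i. P i \<in> borel_measurable M"
    and pvalue_range: "\<And>i \<omega>. \<omega> \<in> space M \<Longrightarrow> P i \<omega> \<in> {0..1}"
    and valid: "\<And>Pr. Pr \<in> Model \<Longrightarrow> valid_pvalues Pr P (true_nulls H Pr)"
    and batches: "batch_index b"
    and indep: "\<And>Pr. Pr \<in> Model \<Longrightarrow> batches_independent Pr P b"
    and alpha: "0 < \<alpha>" "\<alpha> < 1"
    and lam_range: "\<And>i \<omega>. \<omega> \<in> space M \<Longrightarrow> lam (b i) \<omega> \<in> {0..<1}"
    and lam_meas: "\<And>i. lam (b i) \<in> borel_measurable (past_algebra M P b (b i))"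
    and \<gamma>_nonneg: "\<And>i \<omega>. \<omega> \<in> space M \<Longrightarrow> 0 \<le> \<gamma> i \<omega>"
    and \<gamma>_sums: "\<And>\<omega>. \<omega> \<in> space M \<Longrightarrow> (\<lambda>i. \<gamma> i \<omega>) sums 1"
    and \<gamma>_meas: "\<And>i. \<gamma> i \<in> borel_measurable (past_algebra M P b (b i))"
    and g_nonneg: "\<And>j i \<omega>. \<omega> \<in> space M \<Longrightarrow> j < i \<Longrightarrow> 0 \<le> g j i \<omega>"
    and g_same_batch: "\<And>j i \<omega>. \<omega> \<in> space M \<Longrightarrow> j < i \<Longrightarrow> b j = b i \<Longrightarrow> g j i \<omega> = 0"
    and g_sum: "\<And>j \<omega>. \<omega> \<in> space M \<Longrightarrow>
      (\<lambda>i. g j i \<omega>) summable_on {i. b i > b j} \<and> (\<Sum>\<^sub>\<infinity>i\<in>{i. b i > b j}. g j i \<omega>) \<le> 1"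
    and g_meas: "\<And>j i. j < i \<Longrightarrow> g j i \<in> borel_measurable (past_algebra M P b (b i))"
  shows "(\<forall>i. graph_level Q P b lam \<gamma> g \<alpha> i \<in> borel_measurable (past_algebra M P b (b i))) \<and>
    (\<forall>\<omega>\<in>space M. \<forall>i.
      (\<Sum>j\<le>i. corr_level Q P b lam \<gamma> g \<alpha> j \<omega> / (1 - lam (b j) \<omega>) * (1 - cand P b lam j \<omega>)) \<le> \<alpha>) \<and>
    (subset_pivotality Model H Q P \<longrightarrow>
      (\<forall>Pr\<in>Model. FWER Pr (true_nulls H Pr) P (graph_level Q P b lam \<gamma> g \<alpha>) \<le> \<alpha>))"
proof -
  \<comment> \<open>Under \<open>Q\<close> every hypothesis is true, so validity of true nulls in
    the model covers all p-values under \<open>Q\<close>.\<close>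
  have Q: "Q \<in> Model" and null_Q: "true_nulls H Q = UNIV"
    using global_null null_hypotheses by (auto simp: true_nulls_def)
  interpret corr_graph Q M P b lam \<gamma> g \<alpha>
  proof (intro corr_graph.intro corr_graph_axioms.intro)
    show "prob_space Q" "sets Q = sets M"
      using model[OF Q] by auto
    show "measure Q {\<omega> \<in> space Q. P i \<omega> \<le> x} \<le> x" if "x \<in> {0..1}" for i x
      using valid[OF Q] that by (simp add: valid_pvalues_def null_Q)
    show "mono b"
      using batches by (simp add: batch_index_def)
    show "0 \<le> \<alpha>"
      using alpha by simp
  qed (fact pvalue_meas lam_range lam_meas \<gamma>_nonneg \<gamma>_sums \<gamma>_meas g_nonneg g_sum g_meas)+
  have "FWER Pr (true_nulls H Pr) P lev \<le> \<alpha>" if "subset_pivotality Model H Q P" "Pr \<in> Model" for Pr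
  proof (rule FWER_le)
    show "prob_space Pr" "sets Pr = sets M"
      using model[OF that(2)] by auto
    \<comment> \<open>\<open>Pr\<close> satisfies the intersection of exactly those hypotheses that
      are true for it, which is the case of pivotality that \<open>FWER_le\<close> asks for.\<close>
    have "Pr \<in> Model \<inter> (\<Inter>i\<in>true_nulls H Pr. H i)"
      using that(2) by (auto simp: true_nulls_def)
    then show "distr Pr (PiM (true_nulls H Pr) (\<lambda>_. borel)) (pvalue_vector P (true_nulls H Pr))
        = distr Q (PiM (true_nulls H Pr) (\<lambda>_. borel)) (pvalue_vector P (true_nulls H Pr))"
      using that(1) unfolding subset_pivotality_def by blast
  qed (fact indep[OF that(2)] valid[OF that(2)])+
  then show ?thesis
    using lev_meas sum_spent_le by (simp add: spent_def)
qed

end
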